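(* For nonzero parameters $a,b,c\in\mathbb C$, the map $$T_{a,b,c}:(x_1,x_2,y_1,y_2,z_1,z_2)\mapsto\left(y_1,\ \frac{ax_1x_2y_2}{ay_2z_1+bx_1x_2z_2},\ x_1,\ \frac{bx_2z_2}{ac},\ \frac{y_1z_1}{x_1},\ \frac{ay_2z_1+bx_1x_2z_2}{ax_1x_2}\right)$$ is a six-dimensional parametric tetrahedron map, and it is noninvolutive and birational. Moreover, it admits the invariants $$I_1=x_1y_1,\qquad I_2=x_1+y_1,\qquad I_3=y_1z_1.$$
   Context: All maps are rational maps and identities between them are understood as identities of rational functions. The components of the image are denoted $(u_1,u_2,v_1,v_2,w_1,w_2)$; a function $I$ is an invariant if replacing $x_i,y_i,z_i$ by $u_i,v_i,w_i$ does not change its value. Birational means that the map has a rational inverse; noninvolutive means $T_{a,b,c}\circ T_{a,b,c}\neq\mathrm{id}$. Parametric tetrahedron map: a family of rational maps $T_{a,b,c}:\mathcal X^3\to\mathcal X^3$ is a parametric tetrahedron map if $$T^{123}_{a,b,c}\circ T^{145}_{a,d,e}\circ T^{246}_{b,d,f}\circ T^{356}_{c,e,f}=T^{356}_{c,e,f}\circ T^{246}_{b,d,f}\circ T^{145}_{a,d,e}\circ T^{123}_{a,b,c}$$ on $\mathcal X^6$ for all parameters $a,b,c,d,e,f$, where $T^{ijk}$ acts as $T$ on the $i$-th, $j$-th, $k$-th factors (in this order) of $\mathcal X^6$ and as the identity on the others. Here $\mathcal X=\mathbb C^2$, the three factors having coordinates $(x_1,x_2)$, $(y_1,y_2)$,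 $(z_1,z_2)$ and the image $(u_1,u_2)$, $(v_1,v_2)$, $(w_1,w_2)$. *)

theory Defs
  imports
    Complex_Main
    "HOL-Library.Poly_Mapping"
    "HOL-Library.Numeral_Type"
    "HOL-Library.Product_Lexorder"
    "HOL-Computational_Algebra.Fraction_Field"
begin

section \<open>Rational functions and rational maps over the complex numbers\<close>

text \<open>
  A polynomial with variables indexed by \<open>'v\<close> is a finitely supported map from exponent vectors
  to coefficients, with the convolution product of \<^theory>\<open>HOL-Library.Poly_Mapping\<close>. A rational
  function is an element of the fraction field of this polynomial ring, so an equation between
  rational functions is an identity of formal fractions and does not refer to values at points
  (nor to the convention \<open>x / 0 = 0\<close> at points). The linear order on \<open>'v\<close> is only used to obtain
  the library's class instance saying that the polynomial ring is an integral domain.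
\<close>

type_synonym 'v mpol = "('v \<Rightarrow>\<^sub>0 nat) \<Rightarrow>\<^sub>0 complex"
type_synonym 'v ratfun = "'v mpol fract"

text \<open>A rational map from affine \<open>'v\<close>-space to affine \<open>'w\<close>-space, given by its components.\<close>

type_synonym ('v, 'w) ratmap = "'w \<Rightarrow> 'v ratfun"

definition cst :: "complex \<Rightarrow> 'v::linorder ratfun" where
  "cst a = Fract (Poly_Mapping.single 0 a) 1"

definition coord :: "'v::linorder \<Rightarrow> 'v ratfun" where
  "coord v = Fract (Poly_Mapping.single (Poly_Mapping.single v 1) 1) 1"

definition mpol_eval :: "('w \<Rightarrow> 'v::linorder ratfun) \<Rightarrow> 'w mpol \<Rightarrow> 'v ratfun" where
  "mpol_eval g p =
     (\<Sum>m\<in>Poly_Mapping.keys p. cst (Poly_Mapping.lookup p m) *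
        (\<Prod>i\<in>Poly_Mapping.keys m. g i ^ Poly_Mapping.lookup m i))"

text \<open>
  Substituting \<open>g\<close> into a rational function \<open>f\<close> is possible iff \<open>f\<close> can be written as a fraction
  whose denominator does not become the zero function under the substitution. The value then does
  not depend on the chosen fraction. \<open>None\<close> means that the substitution is not possible.
\<close>

definition is_subst ::
  "'w::linorder ratfun \<Rightarrow> ('w \<Rightarrow> 'v::linorder ratfun) \<Rightarrow> 'v ratfun \<Rightarrow> bool" where
  "is_subst f g h \<longleftrightarrow>
     (\<exists>p q. f = Fract p q \<and> mpol_eval g q \<noteq> 0 \<and> h = mpol_eval g p / mpol_eval g q)"

definition subst_ratfun ::
  "'w::linorder ratfun \<Rightarrow> ('w \<Rightarrow> 'v::linorder ratfun) \<Rightarrow> 'v ratfun option" where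
  "subst_ratfun f g = (if \<exists>h. is_subst f g h then Some (THE h. is_subst f g h) else None)"

definition all_defined :: "('w \<Rightarrow> 'a option) \<Rightarrow> ('w \<Rightarrow> 'a) option" where
  "all_defined F = (if \<forall>w. F w \<noteq> None then Some (\<lambda>w. the (F w)) else None)"

text \<open>
  Composition \<open>F \<circ> G\<close> of rational maps (\<open>G\<close> is applied first), as a partial operation: \<open>None\<close> stands
  for an undefined composite.
\<close>

definition comp_ratmap ::
  "('w::linorder, 'u) ratmap option \<Rightarrow> ('v::linorder, 'w) ratmap option \<Rightarrow> ('v, 'u) ratmap option"
  (infixr "\<circ>\<^sub>r" 55) where
  "F \<circ>\<^sub>r G = Option.bind F (\<lambda>f. Option.bind G (\<lambda>g. all_defined (\<lambda>u. subst_ratfun (f u) g)))"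

definition id_ratmap :: "('v::linorder, 'v) ratmap" where
  "id_ratmap = coord"

definition birational :: "('v::linorder, 'w::linorder) ratmap \<Rightarrow> bool" where
  "birational F \<longleftrightarrow>
     (\<exists>G. Some G \<circ>\<^sub>r Some F = Some id_ratmap \<and> Some F \<circ>\<^sub>r Some G = Some id_ratmap)"

definition noninvolutive :: "('v::linorder, 'v) ratmap \<Rightarrow> bool" where
  "noninvolutive F \<longleftrightarrow>
     Some F \<circ>\<^sub>r Some F \<noteq> None \<and> Some F \<circ>\<^sub>r Some F \<noteq> Some id_ratmap"

definition invariant :: "('v::linorder, 'v) ratmap \<Rightarrow> 'v ratfun \<Rightarrow> bool" where
  "invariant F I \<longleftrightarrow> subst_ratfun I F = Some I"

section \<open>Parametric tetrahedron maps\<close>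

text \<open>
  Let \<open>\<X>\<close> be affine \<open>'m\<close>-space. The coordinates of \<open>\<X>\<^sup>3\<close> and \<open>\<X>\<^sup>6\<close> are indexed by \<open>3 \<times> 'm\<close> and
  \<open>6 \<times> 'm\<close>: the pair \<open>(p, r)\<close> is the \<open>r\<close>-th coordinate of the \<open>p\<close>-th factor. The numeral types
  \<open>2\<close>, \<open>3\<close>, \<open>6\<close> have modular arithmetic, so \<open>1, 2\<close> (resp. \<open>1, 2, 3\<close> and \<open>1, \<dots>, 6\<close>) are exactly their
  elements, the last one being equal to \<open>0\<close>.
\<close>

definition sel3 :: "'a \<Rightarrow> 'a \<Rightarrow> 'a \<Rightarrow> 3 \<Rightarrow> 'a" where
  "sel3 x y z p = (if p = 1 then x else if p = 2 then y else z)"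

text \<open>
  \<open>T\<^sup>i\<^sup>j\<^sup>k\<close> acts as \<open>T\<close> on the factors \<open>i, j, k\<close> (in this order) of \<open>\<X>\<^sup>6\<close> and as the identity on the
  other factors.
\<close>

definition act_on ::
  "6 \<Rightarrow> 6 \<Rightarrow> 6 \<Rightarrow> (3 \<times> 'm::linorder, 3 \<times> 'm) ratmap \<Rightarrow> (6 \<times> 'm, 6 \<times> 'm) ratmap option" where
  "act_on i j k T =
     (let \<pi> = (\<lambda>(p, s). coord (sel3 i j k p, s)) in
      all_defined (\<lambda>(l, r).
        if l = i then subst_ratfun (T (1, r)) \<pi>
        else if l = j then subst_ratfun (T (2, r)) \<pi>
        else if l = k then subst_ratfun (T (3, r)) \<pi>
        else Some (coord (l, r))))"

text \<open>\<open>P\<close> is the set of admissible parameter values.\<close>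

definition parametric_tetrahedron_map ::
  "'p set \<Rightarrow> ('p \<Rightarrow> 'p \<Rightarrow> 'p \<Rightarrow> (3 \<times> 'm::{finite,linorder}, 3 \<times> 'm) ratmap) \<Rightarrow> bool" where
  "parametric_tetrahedron_map P T \<longleftrightarrow>
     (\<forall>a\<in>P. \<forall>b\<in>P. \<forall>c\<in>P. \<forall>d\<in>P. \<forall>e\<in>P. \<forall>f\<in>P.
        let L = act_on 1 2 3 (T a b c) \<circ>\<^sub>r act_on 1 4 5 (T a d e) \<circ>\<^sub>r
                act_on 2 4 6 (T b d f) \<circ>\<^sub>r act_on 3 5 6 (T c e f);
            R = act_on 3 5 6 (T c e f) \<circ>\<^sub>r act_on 2 4 6 (T b d f) \<circ>\<^sub>r
                act_on 1 4 5 (T a d e) \<circ>\<^sub>r act_on 1 2 3 (T a b c)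
        in L \<noteq> None \<and> R \<noteq> None \<and> L = R)"

section \<open>The map\<close>

abbreviation x\<^sub>1 :: "(3 \<times> 2) ratfun" where "x\<^sub>1 \<equiv> coord (1, 1)"
abbreviation x\<^sub>2 :: "(3 \<times> 2) ratfun" where "x\<^sub>2 \<equiv> coord (1, 2)"
abbreviation y\<^sub>1 :: "(3 \<times> 2) ratfun" where "y\<^sub>1 \<equiv> coord (2, 1)"
abbreviation y\<^sub>2 :: "(3 \<times> 2) ratfun" where "y\<^sub>2 \<equiv> coord (2, 2)"
abbreviation z\<^sub>1 :: "(3 \<times> 2) ratfun" where "z\<^sub>1 \<equiv> coord (3, 1)"
abbreviation z\<^sub>2 :: "(3 \<times> 2) ratfun" where "z\<^sub>2 \<equiv> coord (3, 2)"

definition map6 :: "'a \<Rightarrow> 'a \<Rightarrow> 'a \<Rightarrow> 'a \<Rightarrow> 'a \<Rightarrow> 'a \<Rightarrow> 3 \<times> 2 \<Rightarrow> 'a" where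
  "map6 u\<^sub>1 u\<^sub>2 v\<^sub>1 v\<^sub>2 w\<^sub>1 w\<^sub>2 =
     (\<lambda>(p, r). if r = 1 then sel3 u\<^sub>1 v\<^sub>1 w\<^sub>1 p else sel3 u\<^sub>2 v\<^sub>2 w\<^sub>2 p)"

definition T_map :: "complex \<Rightarrow> complex \<Rightarrow> complex \<Rightarrow> (3 \<times> 2, 3 \<times> 2) ratmap" where
  "T_map a b c = map6
     y\<^sub>1
     ((cst a * x\<^sub>1 * x\<^sub>2 * y\<^sub>2) / (cst a * y\<^sub>2 * z\<^sub>1 + cst b * x\<^sub>1 * x\<^sub>2 * z\<^sub>2))
     x\<^sub>1
     ((cst b * x\<^sub>2 * z\<^sub>2) / (cst a * cst c))
     ((y\<^sub>1 * z\<^sub>1) / x\<^sub>1)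
     ((cst a * y\<^sub>2 * z\<^sub>1 + cst b * x\<^sub>1 * x\<^sub>2 * z\<^sub>2) / (cst a * x\<^sub>1 * x\<^sub>2))"

end

(*
  Substitution of a tuple g into a rational function is additive and multiplicative wherever it is
  defined, so composing rational maps amounts to evaluating the formulas of T step by step at the
  generic point, provided that no denominator vanishes there. Each denominator is shown to be nonzero
  by setting a single variable to 0 and the others to 1. After this, the tetrahedron equation is a
  comparison of two explicit lists of fractions.

  T has the rational inverse
    x1 = v1,  x2 = (u2 w1 w2 + c u1 v2) / (u1 w2),  y1 = u1,  y2 = u2 w2,
    z1 = v1 w1 / u1,  z2 = a c u1 v2 w2 / (b (u2 w1 w2 + c u1 v2)).
  The second component of T o T equals x2 only if
    (x2 z1 z2 + c x1 y2) (a y2 z1 + b x1 x2 z2) = a x1^2 x2 y2 z2,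
  which fails at x2 = 0. The other components do not settle this for all parameters: if b = a c,
  then T o T fixes x1, y1, z1 and y2.
*)

theory Submission
  imports Defs
begin

section \<open>Substitution into rational functions\<close>

lemma cst_add: "cst (a + b) = cst a + cst b"
  by (simp add: cst_def single_add)

lemma cst_mult: "cst (a * b) = cst a * cst b"
  by (simp add: cst_def mult_single)

lemma cst_0 [simp]: "cst 0 = 0"
  by (simp add: cst_def Zero_fract_def)

lemma cst_1 [simp]: "cst 1 = 1"
  by (simp add: cst_def One_fract_def)

lemma cst_eq_0_iff [simp]: "cst a = 0 \<longleftrightarrow> a = 0"
proof
  assume "cst a = (0 :: 'a ratfun)"
  then have "Poly_Mapping.single 0 a = (0 :: 'a mpol)"
    by (simp add: cst_def Zero_fract_def eq_fract)
  then show "a = 0"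
    by (metis lookup_single_eq lookup_zero)
qed simp

definition mono_eval :: "('w \<Rightarrow> 'v::linorder ratfun) \<Rightarrow> ('w \<Rightarrow>\<^sub>0 nat) \<Rightarrow> 'v ratfun" where
  "mono_eval g m = (\<Prod>i\<in>Poly_Mapping.keys m. g i ^ Poly_Mapping.lookup m i)"

text \<open>Variables outside \<open>keys m\<close> have exponent 0 and contribute the factor 1. Two
  monomials can thus be expanded over one common index set.\<close>

lemma mono_eval_superset:
  assumes "finite A" "Poly_Mapping.keys m \<subseteq> A"
  shows "mono_eval g m = (\<Prod>i\<in>A. g i ^ Poly_Mapping.lookup m i)"
  unfolding mono_eval_def using assms
  by (intro prod.mono_neutral_left) (auto simp: in_keys_iff)

lemma mono_eval_add: "mono_eval g (m + n) = mono_eval g m * mono_eval g n"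
proof -
  let ?A = "Poly_Mapping.keys m \<union> Poly_Mapping.keys n"
  have "mono_eval g (m + n) = (\<Prod>i\<in>?A. g i ^ Poly_Mapping.lookup (m + n) i)"
    using keys_add[of m n] by (intro mono_eval_superset) auto
  then show ?thesis
    by (simp add: mono_eval_superset[of ?A m] mono_eval_superset[of ?A n]
        lookup_add power_add prod.distrib)
qed

lemma mpol_eval_superset:
  assumes "finite A" "Poly_Mapping.keys p \<subseteq> A"
  shows "mpol_eval g p = (\<Sum>m\<in>A. cst (Poly_Mapping.lookup p m) * mono_eval g m)"
  unfolding mpol_eval_def mono_eval_def[symmetric] using assms
  by (intro sum.mono_neutral_left) (auto simp: in_keys_iff)

lemma mpol_eval_0 [simp]: "mpol_eval g 0 = 0"
  by (simp add: mpol_eval_def)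

lemma mpol_eval_add: "mpol_eval g (p + q) = mpol_eval g p + mpol_eval g q"
proof -
  let ?A = "Poly_Mapping.keys p \<union> Poly_Mapping.keys q"
  have "mpol_eval g (p + q)
      = (\<Sum>m\<in>?A. cst (Poly_Mapping.lookup (p + q) m) * mono_eval g m)"
    using keys_add[of p q] by (intro mpol_eval_superset) auto
  then show ?thesis
    by (simp add: mpol_eval_superset[of ?A p] mpol_eval_superset[of ?A q]
        lookup_add cst_add distrib_right sum.distrib)
qed

lemma mpol_eval_sum: "mpol_eval g (sum f A) = (\<Sum>i\<in>A. mpol_eval g (f i))"
  by (induction A rule: infinite_finite_induct) (auto simp: mpol_eval_add)

lemma mpol_eval_single:
  "mpol_eval g (Poly_Mapping.single m a) = cst a * mono_eval g m"
  using mpol_eval_superset[of "{m}" "Poly_Mapping.single m a" g] by simp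

lemma poly_mapping_sum_single:
  "(\<Sum>m\<in>Poly_Mapping.keys p. Poly_Mapping.single m (Poly_Mapping.lookup p m)) = p"
  by (rule poly_mapping_eqI)
    (auto simp: lookup_sum lookup_single when_def in_keys_iff)

text \<open>Both factors are written as sums of single terms and the product is expanded, which
  leaves only the multiplicativity of \<open>cst\<close> and \<open>mono_eval\<close>.\<close>

lemma mpol_eval_mult: "mpol_eval g (p * q) = mpol_eval g p * mpol_eval g q"
proof -
  have "p * q = (\<Sum>m\<in>Poly_Mapping.keys p. \<Sum>n\<in>Poly_Mapping.keys q.
      Poly_Mapping.single (m + n) (Poly_Mapping.lookup p m * Poly_Mapping.lookup q n))"
    unfolding mult_single[symmetric] sum_product[symmetric] poly_mapping_sum_single ..
  then have "mpol_eval g (p * q) = (\<Sum>m\<in>Poly_Mapping.keys p. \<Sum>n\<in>Poly_Mapping.keys q.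
      (cst (Poly_Mapping.lookup p m) * mono_eval g m) *
      (cst (Poly_Mapping.lookup q n) * mono_eval g n))"
    by (simp add: mpol_eval_sum mpol_eval_single cst_mult mono_eval_add mult_ac)
  then show ?thesis
    unfolding sum_product[symmetric] mpol_eval_def mono_eval_def .
qed

lemma mpol_eval_1 [simp]: "mpol_eval g 1 = 1"
  using mpol_eval_single[of g 0 1] by (simp add: mono_eval_def)

section \<open>Substitution into fractions: uniqueness and calculation rules\<close>

text \<open>Cross-multiplying two representations of \<open>f\<close> gives a polynomial identity,
  and \<open>mpol_eval g\<close> preserves it. This makes the \<open>THE\<close> in
  \<open>subst_ratfun\<close> well defined.\<close>

lemma is_subst_unique:
  assumes "is_subst f g h" "is_subst f g h'"
  shows "h = h'"
proof -
  obtain p q where pq: "f = Fract p q" "mpol_eval g q \<noteq> 0" "h = mpol_eval g p / mpol_eval g q"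
    using assms(1) unfolding is_subst_def by blast
  obtain p' q' where pq': "f = Fract p' q'" "mpol_eval g q' \<noteq> 0"
    "h' = mpol_eval g p' / mpol_eval g q'"
    using assms(2) unfolding is_subst_def by blast
  \<comment> \<open>A zero denominator would evaluate to 0. This excludes the convention
    \<open>Fract p 0 = 0\<close>, for which cross-multiplication fails.\<close>
  have "q \<noteq> 0" "q' \<noteq> 0"
    using pq pq' by auto
  then have "p * q' = p' * q"
    using pq(1) pq'(1) by (simp add: eq_fract)
  then have "mpol_eval g p * mpol_eval g q' = mpol_eval g p' * mpol_eval g q"
    by (metis mpol_eval_mult)
  then show ?thesis
    using pq pq' by (simp add: frac_eq_eq)
qed

lemma subst_ratfun_eqI: "is_subst f g h \<Longrightarrow> subst_ratfun f g = Some h"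
  unfolding subst_ratfun_def using is_subst_unique by (auto intro!: the_equality)

lemma is_subst_cst: "is_subst (cst a) g (cst a)"
  unfolding is_subst_def
  by (rule exI[of _ "Poly_Mapping.single 0 a"], rule exI[of _ 1])
    (simp add: cst_def[of a] mpol_eval_single mono_eval_def)

lemma is_subst_coord: "is_subst (coord v) g (g v)"
  unfolding is_subst_def
  by (rule exI[of _ "Poly_Mapping.single (Poly_Mapping.single v 1) 1"], rule exI[of _ 1])
    (simp add: coord_def mpol_eval_single mono_eval_def)

lemma is_subst_add:
  assumes "is_subst f g h" "is_subst f' g h'"
  shows "is_subst (f + f') g (h + h')"
proof -
  obtain p q where pq: "f = Fract p q" "mpol_eval g q \<noteq> 0" "h = mpol_eval g p / mpol_eval g q"
    using assms(1) unfolding is_subst_def by blast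
  obtain p' q' where pq': "f' = Fract p' q'" "mpol_eval g q' \<noteq> 0"
    "h' = mpol_eval g p' / mpol_eval g q'"
    using assms(2) unfolding is_subst_def by blast
  have "q \<noteq> 0" "q' \<noteq> 0"
    using pq pq' by auto
  then show ?thesis
    unfolding is_subst_def using pq pq'
    by (intro exI[of _ "p * q' + p' * q"] exI[of _ "q * q'"])
      (auto simp: mpol_eval_add mpol_eval_mult field_simps)
qed

lemma is_subst_mult:
  assumes "is_subst f g h" "is_subst f' g h'"
  shows "is_subst (f * f') g (h * h')"
proof -
  obtain p q where pq: "f = Fract p q" "mpol_eval g q \<noteq> 0" "h = mpol_eval g p / mpol_eval g q"
    using assms(1) unfolding is_subst_def by blast
  obtain p' q' where pq': "f' = Fract p' q'" "mpol_eval g q' \<noteq> 0"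
    "h' = mpol_eval g p' / mpol_eval g q'"
    using assms(2) unfolding is_subst_def by blast
  show ?thesis
    unfolding is_subst_def using pq pq'
    by (intro exI[of _ "p * p'"] exI[of _ "q * q'"]) (auto simp: mpol_eval_mult)
qed

text \<open>The numerator of \<open>f'\<close> becomes a factor of the new denominator, and
  \<open>h' \<noteq> 0\<close> ensures that it does not evaluate to 0.\<close>

lemma is_subst_divide:
  assumes "is_subst f g h" "is_subst f' g h'" "h' \<noteq> 0"
  shows "is_subst (f / f') g (h / h')"
proof -
  obtain p q where pq: "f = Fract p q" "mpol_eval g q \<noteq> 0" "h = mpol_eval g p / mpol_eval g q"
    using assms(1) unfolding is_subst_def by blast
  obtain p' q' where pq': "f' = Fract p' q'" "mpol_eval g q' \<noteq> 0"
    "h' = mpol_eval g p' / mpol_eval g q'"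
    using assms(2) unfolding is_subst_def by blast
  show ?thesis
    unfolding is_subst_def using pq pq' assms(3)
    by (intro exI[of _ "p * q'"] exI[of _ "q * p'"]) (auto simp: mpol_eval_mult)
qed

lemmas is_subst_intros =
  is_subst_cst is_subst_coord is_subst_add is_subst_mult is_subst_divide

text \<open>Specialising the variables is how rational functions are shown to be nonzero below.\<close>

lemma is_subst_nonzero:
  assumes "is_subst f g h" "h \<noteq> 0"
  shows "f \<noteq> 0"
  using is_subst_unique[OF assms(1), of 0] is_subst_cst[of 0 g] assms(2) by auto

lemma coord_nonzero [simp]: "coord v \<noteq> 0"
  using is_subst_nonzero[OF is_subst_coord[of v "\<lambda>_. 1"]] by simp

lemma all_defined_eqI:
  assumes "\<And>u. F u = Some (f u)"
  shows "all_defined F = Some f"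
  using assms by (simp add: all_defined_def)

text \<open>A composite is computed by exhibiting its components \<open>h\<close>; that it is
  defined comes out at the same time.\<close>

lemma comp_ratmap_eqI:
  assumes "\<And>u. is_subst (f u) g (h u)"
  shows "Some f \<circ>\<^sub>r Some g = Some h"
  using assms by (simp add: comp_ratmap_def subst_ratfun_eqI all_defined_eqI)

section \<open>The map at a point\<close>

lemma cases_2: "(r :: 2) = 1 \<or> r = 2"
proof (induct r)
  case (of_int z)
  \<comment> \<open>The induction rule represents \<open>r\<close> by a residue 0 or 1, and the
    residue 0 is the element \<open>2\<close>.\<close>
  then have "z = 0 \<or> z = 1" by auto
  then show ?case by auto
qed

lemma cases_3: "(p :: 3) = 1 \<or> p = 2 \<or> p = 3"
proof (induct p)
  case (of_int z)
  then have "z = 0 \<or> z = 1 \<or> z = 2" by auto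
  then show ?case by auto
qed

lemma cases_6: "(l :: 6) = 1 \<or> l = 2 \<or> l = 3 \<or> l = 4 \<or> l = 5 \<or> l = 6"
proof (induct l)
  case (of_int z)
  then have "z = 0 \<or> z = 1 \<or> z = 2 \<or> z = 3 \<or> z = 4 \<or> z = 5" by auto
  then show ?case by auto
qed

lemma map6_simps [simp]:
  "map6 u1 u2 v1 v2 w1 w2 (1, 1) = u1" "map6 u1 u2 v1 v2 w1 w2 (1, 2) = u2"
  "map6 u1 u2 v1 v2 w1 w2 (2, 1) = v1" "map6 u1 u2 v1 v2 w1 w2 (2, 2) = v2"
  "map6 u1 u2 v1 v2 w1 w2 (3, 1) = w1" "map6 u1 u2 v1 v2 w1 w2 (3, 2) = w2"
  by (simp_all add: map6_def sel3_def)

lemma all_3_2: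
  "(\<forall>v :: 3 \<times> 2. P v) \<longleftrightarrow>
    P (1, 1) \<and> P (1, 2) \<and> P (2, 1) \<and> P (2, 2) \<and> P (3, 1) \<and> P (3, 2)"
proof -
  have "(\<forall>v :: 3 \<times> 2. P v) \<longleftrightarrow> (\<forall>p r. P (p, r))"
    by simp
  also have "\<dots> \<longleftrightarrow> (\<forall>p\<in>{1, 2, 3}. \<forall>r\<in>{1, 2}. P (p, r))"
    using cases_2 cases_3 by blast
  finally show ?thesis by simp
qed

text \<open>Stated over an arbitrary field, so that the formulas can be evaluated at the generic
  point \<open>coord\<close> and again at a point that is already an image.\<close>

definition T_eval :: "'k::field \<Rightarrow> 'k \<Rightarrow> 'k \<Rightarrow> (3 \<times> 2 \<Rightarrow> 'k) \<Rightarrow> 3 \<times> 2 \<Rightarrow> 'k" where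
  "T_eval a b c p = map6
     (p (2, 1))
     ((a * p (1, 1) * p (1, 2) * p (2, 2)) / (a * p (2, 2) * p (3, 1) + b * p (1, 1) * p (1, 2) * p (3, 2)))
     (p (1, 1))
     ((b * p (1, 2) * p (3, 2)) / (a * c))
     ((p (2, 1) * p (3, 1)) / p (1, 1))
     ((a * p (2, 2) * p (3, 1) + b * p (1, 1) * p (1, 2) * p (3, 2)) / (a * p (1, 1) * p (1, 2)))"

lemma T_map_eq_T_eval: "T_map a b c = T_eval (cst a) (cst b) (cst c) coord"
  by (simp add: T_map_def T_eval_def)

lemma is_subst_T_eval:
  assumes p: "\<And>v. is_subst (p v) g (p' v)"
    and "a \<noteq> 0" "c \<noteq> 0" "p' (1, 1) \<noteq> 0" "p' (1, 2) \<noteq> 0"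
    and "cst a * p' (2, 2) * p' (3, 1) + cst b * p' (1, 1) * p' (1, 2) * p' (3, 2) \<noteq> 0"
  shows "is_subst (T_eval (cst a) (cst b) (cst c) p v) g (T_eval (cst a) (cst b) (cst c) p' v)"
proof -
  have "\<forall>v. is_subst (T_eval (cst a) (cst b) (cst c) p v) g
      (T_eval (cst a) (cst b) (cst c) p' v)"
    unfolding all_3_2 T_eval_def map6_simps using assms
    by (intro conjI is_subst_intros p) auto
  then show ?thesis ..
qed

section \<open>The action on three of the six factors\<close>

text \<open>First coordinates \<open>P\<close> and second coordinates \<open>Q\<close> are kept
  apart because the map moves \<open>P\<close> by itself, independently of \<open>Q\<close> and of
  the parameters.\<close>

definition pt :: "(6 \<Rightarrow> 'k) \<Rightarrow> (6 \<Rightarrow> 'k) \<Rightarrow> 6 \<times> 2 \<Rightarrow> 'k" where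
  "pt P Q = (\<lambda>(l, r). if r = 1 then P l else Q l)"

definition T_act ::
  "'k::field \<Rightarrow> 'k \<Rightarrow> 'k \<Rightarrow> 6 \<Rightarrow> 6 \<Rightarrow> 6 \<Rightarrow> (6 \<Rightarrow> 'k) \<Rightarrow> (6 \<Rightarrow> 'k) \<Rightarrow> 6 \<times> 2 \<Rightarrow> 'k"
  where
  "T_act a b c i j k P Q = (let D = a * Q j * P k + b * P i * Q i * Q k in
     pt (P(i := P j, j := P i, k := P j * P k / P i))
        (Q(i := a * P i * Q i * Q j / D, j := b * Q i * Q k / (a * c), k := D / (a * P i * Q i))))"

text \<open>At distinct positions the successive updates in \<open>T_act\<close> do not overwrite
  each other, so they match the case distinction in \<open>act_on\<close>.\<close>

lemma act_on_T_map:
  assumes "i \<noteq> j" "i \<noteq> k" "j \<noteq> k" "a \<noteq> 0" "c \<noteq> 0"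
  shows "act_on i j k (T_map a b c) =
    Some (T_act (cst a) (cst b) (cst c) i j k (\<lambda>l. coord (l, 1)) (\<lambda>l. coord (l, 2)))"
proof -
  define \<pi> :: "3 \<times> 2 \<Rightarrow> (6 \<times> 2) ratfun" where "\<pi> = (\<lambda>(p, s). coord (sel3 i j k p, s))"
  have D: "cst a * \<pi> (2, 2) * \<pi> (3, 1) + cst b * \<pi> (1, 1) * \<pi> (1, 2) * \<pi> (3, 2) \<noteq> 0"
  proof (rule is_subst_nonzero)
    \<comment> \<open>Setting the second coordinate of factor \<open>i\<close> to 0 kills the second
      summand and leaves \<open>cst a\<close>.\<close>
    define g :: "6 \<times> 2 \<Rightarrow> (6 \<times> 2) ratfun" where "g = (\<lambda>v. if v = (i, 2) then 0 else 1)"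
    show "is_subst (cst a * \<pi> (2, 2) * \<pi> (3, 1) + cst b * \<pi> (1, 1) * \<pi> (1, 2) * \<pi> (3, 2)) g
      (cst a * g (j, 2) * g (k, 1) + cst b * g (i, 1) * g (i, 2) * g (k, 2))"
      unfolding \<pi>_def by (simp add: sel3_def is_subst_intros)
    show "cst a * g (j, 2) * g (k, 1) + cst b * g (i, 1) * g (i, 2) * g (k, 2) \<noteq> 0"
      using assms by (simp add: g_def)
  qed
  have nz: "\<pi> v \<noteq> 0" for v
    by (simp add: \<pi>_def split: prod.split)
  have "subst_ratfun (T_map a b c v) \<pi> = Some (T_eval (cst a) (cst b) (cst c) \<pi> v)" for v
    unfolding T_map_eq_T_eval
    by (intro subst_ratfun_eqI is_subst_T_eval is_subst_coord nz assms D)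
  note sub = this[unfolded \<pi>_def]
  have "T_act (cst a) (cst b) (cst c) i j k (\<lambda>l. coord (l, 1)) (\<lambda>l. coord (l, 2)) (l, r) =
     (if l = i then T_eval (cst a) (cst b) (cst c) \<pi> (1, r)
      else if l = j then T_eval (cst a) (cst b) (cst c) \<pi> (2, r)
      else if l = k then T_eval (cst a) (cst b) (cst c) \<pi> (3, r)
      else coord (l, r))" for l r
    using cases_2[of r] assms
    by (auto simp: T_act_def Let_def pt_def T_eval_def \<pi>_def sel3_def)
  note T_act = this[unfolded \<pi>_def]
  show ?thesis
    unfolding act_on_def Let_def
    by (rule all_defined_eqI) (auto simp: sub T_act)
qed

lemma is_subst_pt:
  assumes "\<And>l. is_subst (P l) g (P' l)" "\<And>l. is_subst (Q l) g (Q' l)"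
  shows "is_subst (pt P Q v) g (pt P' Q' v)"
  using assms by (simp add: pt_def split: prod.split)

text \<open>Allows a further map to be applied to an explicit point at which no denominator
  vanishes.\<close>

lemma T_act_comp:
  assumes "i \<noteq> j" "i \<noteq> k" "j \<noteq> k" "a \<noteq> 0" "c \<noteq> 0" "P i \<noteq> 0" "Q i \<noteq> 0"
    and "cst a * Q j * P k + cst b * P i * Q i * Q k \<noteq> 0"
  shows "act_on i j k (T_map a b c) \<circ>\<^sub>r Some (pt P Q) =
    Some (T_act (cst a) (cst b) (cst c) i j k P Q)"
proof -
  have P: "is_subst (coord (l, 1)) (pt P Q) (P l)" for l
    using is_subst_coord[of "(l, 1)" "pt P Q"] by (simp add: pt_def)
  have Q: "is_subst (coord (l, 2)) (pt P Q) (Q l)" for l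
    using is_subst_coord[of "(l, 2)" "pt P Q"] by (simp add: pt_def)
  have "is_subst (T_act (cst a) (cst b) (cst c) i j k (\<lambda>l. coord (l, 1)) (\<lambda>l. coord (l, 2)) v)
     (pt P Q) (T_act (cst a) (cst b) (cst c) i j k P Q v)" for v
    unfolding T_act_def Let_def
    by (rule is_subst_pt; unfold fun_upd_def)
      (use assms in \<open>auto intro!: is_subst_cst is_subst_add is_subst_mult is_subst_divide P Q\<close>)
  then show ?thesis
    unfolding act_on_T_map[OF assms(1-5)] by (rule comp_ratmap_eqI)
qed

section \<open>The tetrahedron equation\<close>

definition vec6 :: "'k \<Rightarrow> 'k \<Rightarrow> 'k \<Rightarrow> 'k \<Rightarrow> 'k \<Rightarrow> 'k \<Rightarrow> 6 \<Rightarrow> 'k" where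
  "vec6 x1 x2 x3 x4 x5 x6 l = (if l = 1 then x1 else if l = 2 then x2 else if l = 3 then x3
     else if l = 4 then x4 else if l = 5 then x5 else x6)"

lemma vec6_simps [simp]:
  "vec6 x1 x2 x3 x4 x5 x6 1 = x1" "vec6 x1 x2 x3 x4 x5 x6 2 = x2" "vec6 x1 x2 x3 x4 x5 x6 3 = x3"
  "vec6 x1 x2 x3 x4 x5 x6 4 = x4" "vec6 x1 x2 x3 x4 x5 x6 5 = x5" "vec6 x1 x2 x3 x4 x5 x6 6 = x6"
  by (simp_all add: vec6_def)

lemma vec6_upd [simp]:
  "(vec6 x1 x2 x3 x4 x5 x6)(1 := y) = vec6 y x2 x3 x4 x5 x6"
  "(vec6 x1 x2 x3 x4 x5 x6)(2 := y) = vec6 x1 y x3 x4 x5 x6"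
  "(vec6 x1 x2 x3 x4 x5 x6)(3 := y) = vec6 x1 x2 y x4 x5 x6"
  "(vec6 x1 x2 x3 x4 x5 x6)(4 := y) = vec6 x1 x2 x3 y x5 x6"
  "(vec6 x1 x2 x3 x4 x5 x6)(5 := y) = vec6 x1 x2 x3 x4 y x6"
  "(vec6 x1 x2 x3 x4 x5 x6)(6 := y) = vec6 x1 x2 x3 x4 x5 y"
  using cases_6 by (auto simp: fun_eq_iff vec6_def)

lemma vec6_eta: "vec6 (f 1) (f 2) (f 3) (f 4) (f 5) (f 6) = f"
  using cases_6 by (auto simp: fun_eq_iff vec6_def)

lemma pt_vec6_eqI:
  assumes "x1 = x1'" "x2 = x2'" "x3 = x3'" "x4 = x4'" "x5 = x5'" "x6 = x6'"
    and "y1 = y1'" "y2 = y2'" "y3 = y3'" "y4 = y4'" "y5 = y5'" "y6 = y6'"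
  shows "pt (vec6 x1 x2 x3 x4 x5 x6) (vec6 y1 y2 y3 y4 y5 y6) =
    pt (vec6 x1' x2' x3' x4' x5' x6') (vec6 y1' y2' y3' y4' y5' y6')"
  using assms by simp

lemma T_act_eq:
  assumes "a * Q j * P k + b * P i * Q i * Q k = D"
    and "pt (P(i := P j, j := P i, k := P j * P k / P i))
        (Q(i := a * P i * Q i * Q j / D, j := b * Q i * Q k / (a * c), k := D / (a * P i * Q i))) = g"
  shows "T_act a b c i j k P Q = g"
  using assms by (simp add: T_act_def Let_def)

text \<open>The denominator can be supplied as \<open>D\<close> in factored form, so that its
  nonvanishing is immediate and its factors cancel; the factorization itself becomes a separate
  goal.\<close>

lemma T_act_comp_eq:
  assumes "i \<noteq> j" "i \<noteq> k" "j \<noteq> k" "a \<noteq> 0" "c \<noteq> 0" "P i \<noteq> 0" "Q i \<noteq> 0" "D \<noteq> 0"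
    and "cst a * Q j * P k + cst b * P i * Q i * Q k = D"
    and "pt (P(i := P j, j := P i, k := P j * P k / P i))
        (Q(i := cst a * P i * Q i * Q j / D, j := cst b * Q i * Q k / (cst a * cst c),
          k := D / (cst a * P i * Q i))) = g"
  shows "act_on i j k (T_map a b c) \<circ>\<^sub>r Some (pt P Q) = Some g"
  using assms T_act_comp[of i j k a c P Q b] T_act_eq[of "cst a" Q j P k "cst b" i D "cst c" g]
  by simp

text \<open>
  The polynomials \<open>D\<^sub>1, E\<^sub>2, E\<^sub>3\<close> are the denominators that appear when the left-hand side is
  evaluated at the generic point, \<open>F\<^sub>1, F\<^sub>2\<close> those of the right-hand side. The last denominators
  factor as \<open>D\<^sub>1 F\<^sub>2\<close> and \<open>E\<^sub>2 F\<^sub>1\<close> and the third one is \<open>E\<^sub>3\<close> on both sides, which makes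
  the two results agree.
\<close>

lemma tetrahedron_T_map:
  assumes nz: "a \<noteq> 0" "b \<noteq> 0" "c \<noteq> 0" "d \<noteq> 0" "e \<noteq> 0" "f \<noteq> 0"
  obtains g where
    "act_on 1 2 3 (T_map a b c) \<circ>\<^sub>r act_on 1 4 5 (T_map a d e) \<circ>\<^sub>r
       act_on 2 4 6 (T_map b d f) \<circ>\<^sub>r act_on 3 5 6 (T_map c e f) = Some g"
    "act_on 3 5 6 (T_map c e f) \<circ>\<^sub>r act_on 2 4 6 (T_map b d f) \<circ>\<^sub>r
       act_on 1 4 5 (T_map a d e) \<circ>\<^sub>r act_on 1 2 3 (T_map a b c) = Some g"
proof -
  define p q :: "6 \<Rightarrow> (6 \<times> 2) ratfun" where "p = (\<lambda>l. coord (l, 1))" and "q = (\<lambda>l. coord (l, 2))"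
  \<comment> \<open>Coordinates and constants become opaque names, so that field arithmetic treats
    them as atoms.\<close>
  define p1 p2 p3 p4 p5 p6 where p_defs: "p1 = p 1" "p2 = p 2" "p3 = p 3" "p4 = p 4" "p5 = p 5" "p6 = p 6"
  define q1 q2 q3 q4 q5 q6 where q_defs: "q1 = q 1" "q2 = q 2" "q3 = q 3" "q4 = q 4" "q5 = q 5" "q6 = q 6"
  define A B C D E F :: "(6 \<times> 2) ratfun" where
    cst_defs: "A = cst a" "B = cst b" "C = cst c" "D = cst d" "E = cst e" "F = cst f"
  note defs = p_defs q_defs p_def q_def cst_defs
  have p: "vec6 p1 p2 p3 p4 p5 p6 = (\<lambda>l. coord (l, 1))"
    unfolding p_defs vec6_eta[of p] by (fact p_def)
  have q: "vec6 q1 q2 q3 q4 q5 q6 = (\<lambda>l. coord (l, 2))"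
    unfolding q_defs vec6_eta[of q] by (fact q_def)
  have [simp]: "p1 \<noteq> 0" "p2 \<noteq> 0" "p3 \<noteq> 0" "p4 \<noteq> 0" "p5 \<noteq> 0" "p6 \<noteq> 0"
    "q1 \<noteq> 0" "q2 \<noteq> 0" "q3 \<noteq> 0" "q4 \<noteq> 0" "q5 \<noteq> 0" "q6 \<noteq> 0"
    "A \<noteq> 0" "B \<noteq> 0" "C \<noteq> 0" "D \<noteq> 0" "E \<noteq> 0" "F \<noteq> 0"
    using nz by (simp_all add: defs)
  define D1 where "D1 = C * q5 * p6 + E * p3 * q3 * q6"
  define E2 where "E2 = B * C * q3 * q4 * p5 * p6 + D * p2 * q2 * D1"
  define E3 where "E3 = A * q2 * D1 + B * E * p1 * q1 * q3 * q3 * q6"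
  define F1 where "F1 = A * q2 * p3 + B * p1 * q1 * q3"
  define F2 where "F2 = q4 * p5 * F1 + D * p1 * p2 * q1 * q2 * q5"
  \<comment> \<open>In this and the next four specializations, the variable set to 0 leaves exactly
    one monomial, whose coefficient is a product of nonzero parameters.\<close>
  have [simp]: "D1 \<noteq> 0"
  proof (rule is_subst_nonzero)
    let ?g = "(\<lambda>_. 1)((6, 2) := 0) :: 6 \<times> 2 \<Rightarrow> (6 \<times> 2) ratfun"
    show "is_subst D1 ?g (cst c * ?g (5, 2) * ?g (6, 1) + cst e * ?g (3, 1) * ?g (3, 2) * ?g (6, 2))"
      unfolding D1_def defs by (intro is_subst_intros)
  qed (use nz in simp)
  have [simp]: "E2 \<noteq> 0"
  proof (rule is_subst_nonzero)
    let ?g = "(\<lambda>_. 1)((2, 2) := 0) :: 6 \<times> 2 \<Rightarrow> (6 \<times> 2) ratfun"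
    show "is_subst E2 ?g (cst b * cst c * ?g (3, 2) * ?g (4, 2) * ?g (5, 1) * ?g (6, 1) +
       cst d * ?g (2, 1) * ?g (2, 2) *
       (cst c * ?g (5, 2) * ?g (6, 1) + cst e * ?g (3, 1) * ?g (3, 2) * ?g (6, 2)))"
      unfolding E2_def D1_def defs by (intro is_subst_intros)
  qed (use nz in simp)
  have [simp]: "E3 \<noteq> 0"
  proof (rule is_subst_nonzero)
    let ?g = "(\<lambda>_. 1)((6, 2) := 0) :: 6 \<times> 2 \<Rightarrow> (6 \<times> 2) ratfun"
    show "is_subst E3 ?g (cst a * ?g (2, 2) *
       (cst c * ?g (5, 2) * ?g (6, 1) + cst e * ?g (3, 1) * ?g (3, 2) * ?g (6, 2)) +
       cst b * cst e * ?g (1, 1) * ?g (1, 2) * ?g (3, 2) * ?g (3, 2) * ?g (6, 2))"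
      unfolding E3_def D1_def defs by (intro is_subst_intros)
  qed (use nz in simp)
  have [simp]: "F1 \<noteq> 0"
  proof (rule is_subst_nonzero)
    let ?g = "(\<lambda>_. 1)((1, 2) := 0) :: 6 \<times> 2 \<Rightarrow> (6 \<times> 2) ratfun"
    show "is_subst F1 ?g (cst a * ?g (2, 2) * ?g (3, 1) + cst b * ?g (1, 1) * ?g (1, 2) * ?g (3, 2))"
      unfolding F1_def defs by (intro is_subst_intros)
  qed (use nz in simp)
  have [simp]: "F2 \<noteq> 0"
  proof (rule is_subst_nonzero)
    let ?g = "(\<lambda>_. 1)((1, 2) := 0) :: 6 \<times> 2 \<Rightarrow> (6 \<times> 2) ratfun"
    show "is_subst F2 ?g (?g (4, 2) * ?g (5, 1) *
       (cst a * ?g (2, 2) * ?g (3, 1) + cst b * ?g (1, 1) * ?g (1, 2) * ?g (3, 2)) +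
       cst d * ?g (1, 1) * ?g (2, 1) * ?g (1, 2) * ?g (2, 2) * ?g (5, 2))"
      unfolding F2_def F1_def defs by (intro is_subst_intros)
  qed (use nz in simp)

  \<comment> \<open>\<open>P\<close> and \<open>Q\<close> describe the common image of the generic
    point under both sides.\<close>
  define P where "P = vec6 p4 p2 (p4 * p5 / p2) p1 (p2 * p3 / p1) (p4 * p5 * p6 / (p2 * p3))"
  define Q where "Q = vec6 (A * p1 * p2 * q1 * q2 * q4 / F2) (B * p1 * q1 * q2 * q3 * q5 / E3)
    (B * C * p3 * q3 * F2 / (A * p1 * q1 * E2)) (D * q1 * q3 * q6 / (A * C * F))
    (D * E3 / (A * B * C * F * p1 * q1 * q3)) (E2 / (B * C * p2 * p3 * q2 * q3))"

  \<comment> \<open>Images of the generic point after one, two and three maps of the left-hand side,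
    the rightmost map acting first.\<close>
  let ?L1 = "pt (vec6 p1 p2 p5 p4 p3 (p5 * p6 / p3))
      (vec6 q1 q2 (C * p3 * q3 * q5 / D1) q4 (E * q3 * q6 / (C * F)) (D1 / (C * p3 * q3)))"
  let ?L2 = "pt (vec6 p1 p4 p5 p2 p3 (p4 * p5 * p6 / (p2 * p3)))
      (vec6 q1 (B * C * p2 * p3 * q2 * q3 * q4 / E2) (C * p3 * q3 * q5 / D1)
        (D * q2 * D1 / (B * C * F * p3 * q3)) (E * q3 * q6 / (C * F))
        (E2 / (B * C * p2 * p3 * q2 * q3)))"
  let ?L3 = "pt (vec6 p2 p4 p5 p1 (p2 * p3 / p1) (p4 * p5 * p6 / (p2 * p3)))
      (vec6 (A * p1 * q1 * q2 * D1 / (p3 * E3)) (B * C * p2 * p3 * q2 * q3 * q4 / E2)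
        (C * p3 * q3 * q5 / D1) (D * q1 * q3 * q6 / (A * C * F))
        (D * E3 / (A * B * C * F * p1 * q1 * q3)) (E2 / (B * C * p2 * p3 * q2 * q3)))"
  have L1: "act_on 3 5 6 (T_map c e f) = Some ?L1"
    using nz by (subst act_on_T_map)
      (auto simp: D1_def cst_defs p[symmetric] q[symmetric] intro!: T_act_eq)
  have L2: "act_on 2 4 6 (T_map b d f) \<circ>\<^sub>r Some ?L1 = Some ?L2"
    using nz
    apply (intro T_act_comp_eq[where D = "E2 / (C * p3 * q3)"])
    apply (simp_all add: cst_defs[symmetric])
     apply (simp add: E2_def field_simps)
    apply (intro pt_vec6_eqI; simp add: field_simps)
    done
  have L3: "act_on 1 4 5 (T_map a d e) \<circ>\<^sub>r Some ?L2 = Some ?L3"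
    using nz
    apply (intro T_act_comp_eq[where D = "D * E3 / (B * C * F * q3)"])
    apply (simp_all add: cst_defs[symmetric])
     apply (simp add: E3_def field_simps)
    apply (intro pt_vec6_eqI; simp add: field_simps)
    done
  \<comment> \<open>The numerator of the fourth denominator. Its factor \<open>D1\<close> cancels in
    the result, which leaves \<open>F2\<close>, a denominator of the right-hand side.\<close>
  have E4: "q4 * p3 * p5 * E3 + p1 * q1 * q5 * E2 = D1 * F2"
    by (simp add: E3_def E2_def F2_def F1_def D1_def algebra_simps)
  have L4: "act_on 1 2 3 (T_map a b c) \<circ>\<^sub>r Some ?L3 = Some (pt P Q)"
    using nz unfolding P_def Q_def
    apply (intro T_act_comp_eq[where D = "A * B * C * p2 * q2 * q3 * (D1 * F2) / (E2 * E3)"])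
    apply (simp_all add: cst_defs[symmetric])
     apply (simp add: E4[symmetric] field_simps)
    apply (intro pt_vec6_eqI; simp add: field_simps)
    done

  \<comment> \<open>The corresponding images for the right-hand side.\<close>
  let ?R1 = "pt (vec6 p2 p1 (p2 * p3 / p1) p4 p5 p6)
      (vec6 (A * p1 * q1 * q2 / F1) (B * q1 * q3 / (A * C)) (F1 / (A * p1 * q1)) q4 q5 q6)"
  let ?R2 = "pt (vec6 p4 p1 (p2 * p3 / p1) p2 (p4 * p5 / p2) p6)
      (vec6 (A * p1 * p2 * q1 * q2 * q4 / F2) (B * q1 * q3 / (A * C)) (F1 / (A * p1 * q1))
        (D * p1 * q1 * q2 * q5 / (E * F1)) (F2 / (A * p1 * p2 * q1 * q2)) q6)"
  let ?R3 = "pt (vec6 p4 p2 (p2 * p3 / p1) p1 (p4 * p5 / p2) (p2 * p6 / p1))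
      (vec6 (A * p1 * p2 * q1 * q2 * q4 / F2) (B * p1 * q1 * q2 * q3 * q5 / E3)
        (F1 / (A * p1 * q1)) (D * q1 * q3 * q6 / (A * C * F)) (F2 / (A * p1 * p2 * q1 * q2))
        (D * E3 / (B * E * F1 * q3)))"
  have R1: "act_on 1 2 3 (T_map a b c) = Some ?R1"
    using nz by (subst act_on_T_map)
      (auto simp: F1_def cst_defs p[symmetric] q[symmetric] intro!: T_act_eq)
  have R2: "act_on 1 4 5 (T_map a d e) \<circ>\<^sub>r Some ?R1 = Some ?R2"
    using nz
    apply (intro T_act_comp_eq[where D = "A * F2 / F1"])
    apply (simp_all add: cst_defs[symmetric])
     apply (simp add: F2_def field_simps)
    apply (intro pt_vec6_eqI; simp add: field_simps)
    done
  \<comment> \<open>The right-hand side produces \<open>E3\<close> grouped around \<open>F1\<close>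
    instead of \<open>D1\<close>.\<close>
  have E3_alt: "E3 = A * C * q2 * q5 * p6 + E * q3 * q6 * F1"
    by (simp add: E3_def F1_def D1_def algebra_simps)
  have R3: "act_on 2 4 6 (T_map b d f) \<circ>\<^sub>r Some ?R2 = Some ?R3"
    using nz
    apply (intro T_act_comp_eq[where D = "B * D * p1 * q1 * E3 / (A * C * E * F1)"])
    apply (simp_all add: cst_defs[symmetric])
     apply (simp add: E3_alt field_simps)
    apply (intro pt_vec6_eqI; simp add: field_simps)
    done
  \<comment> \<open>Counterpart of \<open>E4\<close>: here \<open>F1\<close> cancels and
    \<open>E2\<close> is left.\<close>
  have F4: "B * C * q3 * F2 * p6 + D * p2 * p3 * q2 * E3 = E2 * F1"
    by (simp add: E3_def E2_def F2_def F1_def D1_def algebra_simps)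
  have R4: "act_on 3 5 6 (T_map c e f) \<circ>\<^sub>r Some ?R3 = Some (pt P Q)"
    using nz unfolding P_def Q_def
    apply (intro T_act_comp_eq[where D = "E2 * F1 / (A * B * p1 * p1 * q1 * q2 * q3)"])
    apply (simp_all add: cst_defs[symmetric])
     apply (simp add: F4[symmetric] field_simps)
    apply (intro pt_vec6_eqI; simp add: field_simps)
    done
  show thesis
    by (rule that[of "pt P Q"]) (simp only: L1 L2 L3 L4, simp only: R1 R2 R3 R4)
qed

section \<open>Inverse, square and invariants\<close>

text \<open>The argument stands for the image (u, v, w). The first components give x1, y1, z1, and
  y2 = u2 w2. Then x2 follows from w2 x2 = y2 z1 / x1 + c v2, and z2 from v2.\<close>

definition S_eval :: "'k::field \<Rightarrow> 'k \<Rightarrow> 'k \<Rightarrow> (3 \<times> 2 \<Rightarrow> 'k) \<Rightarrow> 3 \<times> 2 \<Rightarrow> 'k" where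
  "S_eval a b c p = map6
     (p (2, 1))
     ((p (1, 2) * p (3, 1) * p (3, 2) + c * p (1, 1) * p (2, 2)) / (p (1, 1) * p (3, 2)))
     (p (1, 1))
     (p (1, 2) * p (3, 2))
     (p (2, 1) * p (3, 1) / p (1, 1))
     (a * c * p (1, 1) * p (2, 2) * p (3, 2) /
       (b * (p (1, 2) * p (3, 1) * p (3, 2) + c * p (1, 1) * p (2, 2))))"

lemma is_subst_S_eval:
  assumes p: "\<And>v. is_subst (p v) g (p' v)"
    and "b \<noteq> 0" "p' (1, 1) \<noteq> 0" "p' (3, 2) \<noteq> 0"
    and "p' (1, 2) * p' (3, 1) * p' (3, 2) + cst c * p' (1, 1) * p' (2, 2) \<noteq> 0"
  shows "is_subst (S_eval (cst a) (cst b) (cst c) p v) g (S_eval (cst a) (cst b) (cst c) p' v)"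
proof -
  have "\<forall>v. is_subst (S_eval (cst a) (cst b) (cst c) p v) g
      (S_eval (cst a) (cst b) (cst c) p' v)"
    unfolding all_3_2 S_eval_def map6_simps using assms
    by (intro conjI is_subst_intros p) auto
  then show ?thesis ..
qed

lemma T_eval_denom_nonzero:
  assumes "a \<noteq> 0"
  shows "cst a * y\<^sub>2 * z\<^sub>1 + cst b * x\<^sub>1 * x\<^sub>2 * z\<^sub>2 \<noteq> 0"
proof (rule is_subst_nonzero)
  let ?g = "(\<lambda>_. 1)((1, 2) := 0) :: 3 \<times> 2 \<Rightarrow> (3 \<times> 2) ratfun"
  show "is_subst (cst a * y\<^sub>2 * z\<^sub>1 + cst b * x\<^sub>1 * x\<^sub>2 * z\<^sub>2) ?g
      (cst a * ?g (2, 2) * ?g (3, 1) + cst b * ?g (1, 1) * ?g (1, 2) * ?g (3, 2))"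
    by (intro is_subst_intros)
qed (use assms in simp)

lemma S_eval_denom_nonzero:
  assumes "c \<noteq> 0"
  shows "x\<^sub>2 * z\<^sub>1 * z\<^sub>2 + cst c * x\<^sub>1 * y\<^sub>2 \<noteq> 0"
proof (rule is_subst_nonzero)
  let ?g = "(\<lambda>_. 1)((1, 2) := 0) :: 3 \<times> 2 \<Rightarrow> (3 \<times> 2) ratfun"
  show "is_subst (x\<^sub>2 * z\<^sub>1 * z\<^sub>2 + cst c * x\<^sub>1 * y\<^sub>2) ?g
      (?g (1, 2) * ?g (3, 1) * ?g (3, 2) + cst c * ?g (1, 1) * ?g (2, 2))"
    by (intro is_subst_intros)
qed (use assms in simp)

lemma birational_T_map:
  assumes nz: "a \<noteq> 0" "b \<noteq> 0" "c \<noteq> 0"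
  shows "birational (T_map a b c)"
proof -
  define S where "S = S_eval (cst a) (cst b) (cst c) (coord :: 3 \<times> 2 \<Rightarrow> _)"
  define G where "G = x\<^sub>2 * z\<^sub>1 * z\<^sub>2 + cst c * x\<^sub>1 * y\<^sub>2"
  define H where "H = cst a * y\<^sub>2 * z\<^sub>1 + cst b * x\<^sub>1 * x\<^sub>2 * z\<^sub>2"
  have [simp]: "G \<noteq> 0" "H \<noteq> 0"
    using S_eval_denom_nonzero T_eval_denom_nonzero nz by (simp_all add: G_def H_def)
  have T: "T_map a b c = map6 y\<^sub>1 (cst a * x\<^sub>1 * x\<^sub>2 * y\<^sub>2 / H) x\<^sub>1 (cst b * x\<^sub>2 * z\<^sub>2 / (cst a * cst c))
      (y\<^sub>1 * z\<^sub>1 / x\<^sub>1) (H / (cst a * x\<^sub>1 * x\<^sub>2))"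
    by (simp add: T_map_def H_def)
  have S: "S = map6 y\<^sub>1 (G / (x\<^sub>1 * z\<^sub>2)) x\<^sub>1 (x\<^sub>2 * z\<^sub>2) (y\<^sub>1 * z\<^sub>1 / x\<^sub>1)
      (cst a * cst c * x\<^sub>1 * y\<^sub>2 * z\<^sub>2 / (cst b * G))"
    by (simp add: S_def S_eval_def G_def)
  let ?T = "T_map a b c"
  \<comment> \<open>The polynomial in the denominator of the inverse, pulled back along T, is a
    Laurent monomial times \<open>H\<close>. It is therefore nonzero and cancels the
    \<open>H\<close> in T.\<close>
  have ST: "?T (1, 2) * ?T (3, 1) * ?T (3, 2) + cst c * ?T (1, 1) * ?T (2, 2) = y\<^sub>1 * H / (cst a * x\<^sub>1)"
    using nz by (simp add: T) (simp add: H_def field_simps)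
  \<comment> \<open>The same in the other order, with \<open>G\<close> in place of
    \<open>H\<close>.\<close>
  have TS: "cst a * S (2, 2) * S (3, 1) + cst b * S (1, 1) * S (1, 2) * S (3, 2) = cst a * y\<^sub>1 * G / x\<^sub>1"
    using nz by (simp add: S) (simp add: G_def field_simps)
  have "S_eval (cst a) (cst b) (cst c) ?T = coord"
    unfolding fun_eq_iff S_eval_def ST all_3_2 using nz by (simp add: T)
  moreover have "is_subst (S v) ?T (S_eval (cst a) (cst b) (cst c) ?T v)" for v
    unfolding S_def by (rule is_subst_S_eval) (use nz ST in \<open>simp_all add: T is_subst_coord\<close>)
  ultimately have 1: "Some S \<circ>\<^sub>r Some ?T = Some id_ratmap"
    unfolding id_ratmap_def by (intro comp_ratmap_eqI) simp
  have "T_eval (cst a) (cst b) (cst c) S = coord"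
    unfolding fun_eq_iff T_eval_def TS all_3_2 using nz by (simp add: S)
  moreover have "is_subst (?T v) S (T_eval (cst a) (cst b) (cst c) S v)" for v
    unfolding T_map_eq_T_eval
    by (rule is_subst_T_eval) (use nz TS in \<open>simp_all add: S is_subst_coord\<close>)
  ultimately have 2: "Some ?T \<circ>\<^sub>r Some S = Some id_ratmap"
    unfolding id_ratmap_def by (intro comp_ratmap_eqI) simp
  show ?thesis
    unfolding birational_def using 1 2 by blast
qed

section \<open>The square of the map\<close>

lemma noninvolutive_T_map:
  assumes nz: "a \<noteq> 0" "b \<noteq> 0" "c \<noteq> 0"
  shows "noninvolutive (T_map a b c)"
proof -
  define G where "G = x\<^sub>2 * z\<^sub>1 * z\<^sub>2 + cst c * x\<^sub>1 * y\<^sub>2"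
  define H where "H = cst a * y\<^sub>2 * z\<^sub>1 + cst b * x\<^sub>1 * x\<^sub>2 * z\<^sub>2"
  have [simp]: "G \<noteq> 0" "H \<noteq> 0"
    using S_eval_denom_nonzero T_eval_denom_nonzero nz by (simp_all add: G_def H_def)
  let ?T = "T_map a b c"
  have T: "?T = map6 y\<^sub>1 (cst a * x\<^sub>1 * x\<^sub>2 * y\<^sub>2 / H) x\<^sub>1 (cst b * x\<^sub>2 * z\<^sub>2 / (cst a * cst c))
      (y\<^sub>1 * z\<^sub>1 / x\<^sub>1) (H / (cst a * x\<^sub>1 * x\<^sub>2))"
    by (simp add: T_map_def H_def)
  \<comment> \<open>Up to a Laurent monomial, the denominator of T at its own image is the
    \<open>G\<close> of the inverse, so the square is defined.\<close>
  have TT: "cst a * ?T (2, 2) * ?T (3, 1) + cst b * ?T (1, 1) * ?T (1, 2) * ?T (3, 2) =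
      cst b * y\<^sub>1 * G / (cst c * x\<^sub>1)"
    using nz by (simp add: T) (simp add: G_def field_simps)
  have "is_subst (?T v) ?T (T_eval (cst a) (cst b) (cst c) ?T v)" for v
    by (subst T_map_eq_T_eval, rule is_subst_T_eval)
      (use nz TT in \<open>simp_all add: T is_subst_coord\<close>)
  then have comp: "Some ?T \<circ>\<^sub>r Some ?T = Some (T_eval (cst a) (cst b) (cst c) ?T)"
    by (rule comp_ratmap_eqI)
  have "T_eval (cst a) (cst b) (cst c) ?T \<noteq> coord"
  proof
    assume "T_eval (cst a) (cst b) (cst c) ?T = coord"
    then have "T_eval (cst a) (cst b) (cst c) ?T (1, 2) = x\<^sub>2"
      by simp
    \<comment> \<open>The second component equated with x2, after clearing denominators and
      cancelling one x2.\<close>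
    then have eq: "G * H = cst a * x\<^sub>1 * x\<^sub>1 * x\<^sub>2 * y\<^sub>2 * z\<^sub>2"
      unfolding T_eval_def TT using nz by (simp add: T field_simps)
    let ?g = "(\<lambda>_. 1)((1, 2) := 0) :: 3 \<times> 2 \<Rightarrow> (3 \<times> 2) ratfun"
    have "is_subst (G * H) ?g
      ((?g (1, 2) * ?g (3, 1) * ?g (3, 2) + cst c * ?g (1, 1) * ?g (2, 2)) *
       (cst a * ?g (2, 2) * ?g (3, 1) + cst b * ?g (1, 1) * ?g (1, 2) * ?g (3, 2)))"
      unfolding G_def H_def by (intro is_subst_intros)
    moreover have "is_subst (G * H) ?g
      (cst a * ?g (1, 1) * ?g (1, 1) * ?g (1, 2) * ?g (2, 2) * ?g (3, 2))"
      unfolding eq by (intro is_subst_intros)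
    \<comment> \<open>One substitution, x2 = 0 and all other variables 1, gives
      \<open>cst c * cst a\<close> on the left and 0 on the right.\<close>
    ultimately have "cst c * cst a = (0 :: (3 \<times> 2) ratfun)"
      using is_subst_unique by fastforce
    then show False
      using nz by simp
  qed
  then show ?thesis
    by (simp add: noninvolutive_def comp id_ratmap_def)
qed

section \<open>Invariants and the complete statement\<close>

lemma invariantI: "is_subst I F I \<Longrightarrow> invariant F I"
  by (simp add: invariant_def subst_ratfun_eqI)

theorem theorem4p6:
  shows "parametric_tetrahedron_map {a. a \<noteq> 0} T_map \<and>
    (\<forall>a b c. a \<noteq> 0 \<longrightarrow> b \<noteq> 0 \<longrightarrow> c \<noteq> 0 \<longrightarrow>
       noninvolutive (T_map a b c) \<and>
       birational (T_map a b c) \<and>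
       invariant (T_map a b c) (x\<^sub>1 * y\<^sub>1) \<and>
       invariant (T_map a b c) (x\<^sub>1 + y\<^sub>1) \<and>
       invariant (T_map a b c) (y\<^sub>1 * z\<^sub>1))"
proof (intro conjI allI impI)
  show "parametric_tetrahedron_map {a. a \<noteq> 0} T_map"
    unfolding parametric_tetrahedron_map_def
  proof (intro ballI)
    fix a b c d e f :: complex
    assume "a \<in> {a. a \<noteq> 0}" "b \<in> {a. a \<noteq> 0}" "c \<in> {a. a \<noteq> 0}"
      "d \<in> {a. a \<noteq> 0}" "e \<in> {a. a \<noteq> 0}" "f \<in> {a. a \<noteq> 0}"
    then obtain g where
      "act_on 1 2 3 (T_map a b c) \<circ>\<^sub>r act_on 1 4 5 (T_map a d e) \<circ>\<^sub>r
         act_on 2 4 6 (T_map b d f) \<circ>\<^sub>r act_on 3 5 6 (T_map c e f) = Some g"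
      "act_on 3 5 6 (T_map c e f) \<circ>\<^sub>r act_on 2 4 6 (T_map b d f) \<circ>\<^sub>r
         act_on 1 4 5 (T_map a d e) \<circ>\<^sub>r act_on 1 2 3 (T_map a b c) = Some g"
      using tetrahedron_T_map[of a b c d e f] by (simp only: mem_Collect_eq) metis
    then show "let
        L = act_on 1 2 3 (T_map a b c) \<circ>\<^sub>r act_on 1 4 5 (T_map a d e) \<circ>\<^sub>r
            act_on 2 4 6 (T_map b d f) \<circ>\<^sub>r act_on 3 5 6 (T_map c e f);
        R = act_on 3 5 6 (T_map c e f) \<circ>\<^sub>r act_on 2 4 6 (T_map b d f) \<circ>\<^sub>r
            act_on 1 4 5 (T_map a d e) \<circ>\<^sub>r act_on 1 2 3 (T_map a b c)
        in L \<noteq> None \<and> R \<noteq> None \<and> L = R"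
      by (simp add: Let_def)
  qed
next
  fix a b c :: complex
  assume nz: "a \<noteq> 0" "b \<noteq> 0" "c \<noteq> 0"
  show "noninvolutive (T_map a b c)" "birational (T_map a b c)"
    by (fact noninvolutive_T_map[OF nz] birational_T_map[OF nz])+
  let ?T = "T_map a b c"
  have T: "?T (1, 1) = y\<^sub>1" "?T (2, 1) = x\<^sub>1" "?T (3, 1) = y\<^sub>1 * z\<^sub>1 / x\<^sub>1"
    by (simp_all add: T_map_def)
  \<comment> \<open>T exchanges x1 and y1, which fixes their symmetric functions; in v1 w1 the
    factor x1 cancels.\<close>
  have "is_subst (x\<^sub>1 * y\<^sub>1) ?T (?T (1, 1) * ?T (2, 1))"
    and "is_subst (x\<^sub>1 + y\<^sub>1) ?T (?T (1, 1) + ?T (2, 1))"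
    and "is_subst (y\<^sub>1 * z\<^sub>1) ?T (?T (2, 1) * ?T (3, 1))"
    by (intro is_subst_intros)+
  then show "invariant ?T (x\<^sub>1 * y\<^sub>1)" "invariant ?T (x\<^sub>1 + y\<^sub>1)" "invariant ?T (y\<^sub>1 * z\<^sub>1)"
    by (simp_all add: invariantI T mult.commute add.commute)
qed

end
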